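(* Let $n\ge 2$, $d\ge 1$ and $1\le s\le \binom{d+n-1}{d}$ be integers. Let $\ell_1,\dots,\ell_s\in[S]_1$ be general linear forms, let $F_s=\ell_1^d+\cdots+\ell_s^d\in[S]_d$, and let $A_{F_s}=R/\operatorname{Ann}_R(F_s)$ be the Artinian Gorenstein graded $\mathbb{K}$-algebra of socle degree $d$ with Macaulay dual generator $F_s$. Then $A_{F_s}$ has the weak Lefschetz property.
   Context: $\mathbb{K}$ is an algebraically closed field of characteristic zero, $R=\mathbb{K}[x_1,\dots,x_n]$ and $S=\mathbb{K}[X_1,\dots,X_n]$ with the standard grading; $[M]_k$ denotes the degree-$k$ component. $R$ acts on $S$ by differentiation, $x_i=\partial/\partial X_i$; $\operatorname{Ann}_R(F)=\{p\in R : p(\partial/\partial X_1,\dots,\partial/\partial X_n)\circ F=0\}$. If $F\neq 0$ is homogeneous of degree $d$, then $R/\operatorname{Ann}_R(F)$ is Artinian Gorenstein of socle degree $d$ and $F$ is called its Macaulay dual generator. A standard graded Artinian $\mathbb{K}$-algebra $A$ has the weak Lefschetz property (WLP) if there is a linear form $\ell\in[A]_1$ such that for all integers $i\ge 0$ the multiplication map $\times\ell:[A]_i\to[A]_{i+1}$ has maximal rank, i.e. is injective or surjective. "General": writing $\ell_i=a_{i,1}X_1+\cdots+a_{i,n}X_n$, a statement holds for general linear forms $\ell_1,\dots,\ell_s$ if there is a nonempty (dense) Zariski open subset $U\subset \mathbb{K}^{ns}$ such that it holds whenever $(a_{1,1},\dots,a_{1,n},\dots,a_{s,1},\dots,a_{s,n})\in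 U$. *)

theory Defs
  imports
    "HOL-Library.Poly_Mapping"
    "HOL-Library.FuncSet"
    "HOL-Computational_Algebra.Polynomial"
    "HOL-Algebra.QuotRing"
begin

text \<open>
  Polynomials in variables indexed by \<open>'i\<close> are finitely supported maps from exponent vectors to
  coefficients; the product of \<^theory>\<open>HOL-Library.Poly_Mapping\<close> is polynomial multiplication.
  The finite set of variables that may occur is given explicitly as a set \<open>I\<close> of indices.
\<close>

type_synonym 'i monom = "'i \<Rightarrow>\<^sub>0 nat"
type_synonym ('i, 'k) mpoly = "'i monom \<Rightarrow>\<^sub>0 'k"

definition mono_degree :: "'i monom \<Rightarrow> nat"
  where "mono_degree m = (\<Sum>i\<in>Poly_Mapping.keys m. Poly_Mapping.lookup m i)"

definition polys :: "'i set \<Rightarrow> ('i, 'k::comm_ring_1) mpoly set"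
  where "polys I = {p. \<forall>m\<in>Poly_Mapping.keys p. Poly_Mapping.keys m \<subseteq> I}"

definition homogeneous_polys :: "'i set \<Rightarrow> nat \<Rightarrow> ('i, 'k::comm_ring_1) mpoly set"
  where "homogeneous_polys I k = {p \<in> polys I. \<forall>m\<in>Poly_Mapping.keys p. mono_degree m = k}"

definition poly_ring :: "'i set \<Rightarrow> ('i, 'k::comm_ring_1) mpoly ring"
  where "poly_ring I = \<lparr>carrier = polys I, mult = (*), one = 1, zero = 0, add = (+)\<rparr>"

definition const_poly :: "'k \<Rightarrow> ('i, 'k::comm_ring_1) mpoly"
  where "const_poly c = Poly_Mapping.single 0 c"

definition var_poly :: "'i \<Rightarrow> ('i, 'k::comm_ring_1) mpoly"
  where "var_poly i = Poly_Mapping.single (Poly_Mapping.single i 1) 1"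

definition eval_poly :: "('i, 'k::comm_ring_1) mpoly \<Rightarrow> ('i \<Rightarrow> 'k) \<Rightarrow> 'k"
  where "eval_poly p a = (\<Sum>m\<in>Poly_Mapping.keys p.
    Poly_Mapping.lookup p m * (\<Prod>i\<in>Poly_Mapping.keys m. a i ^ Poly_Mapping.lookup m i))"

subsection \<open>The action by differentiation\<close>

text \<open>
  Termwise, \<open>\<partial>/\<partial>X\<^sub>i\<close> maps \<open>c X\<^sup>m\<close> to \<open>m\<^sub>i c X\<^bsup>m - e\<^sub>i\<^esup>\<close>. The subtraction of exponents is truncated,
  which only matters for \<open>m\<^sub>i = 0\<close>, when the coefficient vanishes.
\<close>

definition partial_deriv :: "'i \<Rightarrow> ('i, 'k::comm_ring_1) mpoly \<Rightarrow> ('i, 'k) mpoly"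
  where "partial_deriv i F =
    (\<Sum>m\<in>Poly_Mapping.keys F. Poly_Mapping.single (m - Poly_Mapping.single i 1)
      (of_nat (Poly_Mapping.lookup m i) * Poly_Mapping.lookup F m))"

text \<open>
  The operators \<open>\<partial>/\<partial>X\<^sub>i\<close> commute; listing the variables in increasing order merely fixes one order
  of composition.
\<close>

definition mono_deriv :: "'i::linorder monom \<Rightarrow> ('i, 'k::comm_ring_1) mpoly \<Rightarrow> ('i, 'k) mpoly"
  where "mono_deriv m F =
    foldr (\<lambda>i. partial_deriv i ^^ Poly_Mapping.lookup m i) (sorted_list_of_set (Poly_Mapping.keys m)) F"

definition diff_action :: "('i::linorder, 'k::comm_ring_1) mpoly \<Rightarrow> ('i, 'k) mpoly \<Rightarrow> ('i, 'k) mpoly"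
  where "diff_action p F =
    (\<Sum>m\<in>Poly_Mapping.keys p. const_poly (Poly_Mapping.lookup p m) * mono_deriv m F)"

definition Ann :: "'i::linorder set \<Rightarrow> ('i, 'k::comm_ring_1) mpoly \<Rightarrow> ('i, 'k) mpoly set"
  where "Ann I F = {p \<in> polys I. diff_action p F = 0}"

subsection \<open>The algebra with a given Macaulay dual generator\<close>

definition macaulay_algebra ::
    "'i::linorder set \<Rightarrow> ('i, 'k::comm_ring_1) mpoly \<Rightarrow> ('i, 'k) mpoly set ring"
  where "macaulay_algebra I F = poly_ring I Quot Ann I F"

text \<open>For homogeneous \<open>F\<close> the annihilator is homogeneous, so the quotient inherits the grading.\<close>

definition macaulay_component ::
    "'i::linorder set \<Rightarrow> ('i, 'k::comm_ring_1) mpoly \<Rightarrow> nat \<Rightarrow> ('i, 'k) mpoly set set"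
  where "macaulay_component I F k =
    (\<lambda>p. Ann I F +>\<^bsub>poly_ring I\<^esub> p) ` homogeneous_polys I k"

text \<open>The argument \<open>C\<close> is the family of homogeneous components of the graded algebra \<open>A\<close>.\<close>

definition weak_lefschetz :: "('a, 'b) ring_scheme \<Rightarrow> (nat \<Rightarrow> 'a set) \<Rightarrow> bool"
  where "weak_lefschetz A C \<longleftrightarrow>
    (\<exists>l\<in>C 1. \<forall>i.
      inj_on (\<lambda>x. l \<otimes>\<^bsub>A\<^esub> x) (C i) \<or> (\<lambda>x. l \<otimes>\<^bsub>A\<^esub> x) ` C i = C (i + 1))"

subsection \<open>Zariski topology and general linear forms\<close>

text \<open>
  The points of the affine space with coordinates indexed by \<open>I\<close> are the functions in
  \<open>I \<rightarrow>\<^sub>E UNIV\<close>. An open set is the complement of the common zero locus of a set of polynomials.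
\<close>

definition zariski_open :: "'i set \<Rightarrow> ('i \<Rightarrow> 'k::comm_ring_1) set \<Rightarrow> bool"
  where "zariski_open I U \<longleftrightarrow>
    (\<exists>P \<subseteq> polys I. U = {a \<in> I \<rightarrow>\<^sub>E UNIV. \<exists>f\<in>P. eval_poly f a \<noteq> 0})"

definition linear_form :: "nat \<Rightarrow> (nat \<times> nat \<Rightarrow> 'k) \<Rightarrow> nat \<Rightarrow> (nat, 'k::comm_ring_1) mpoly"
  where "linear_form n a i = (\<Sum>j=1..n. const_poly (a (i, j)) * var_poly j)"

text \<open>
  \<open>Q\<close> is a property of the coefficients \<open>a (i, j)\<close> of \<open>s\<close> linear forms in \<open>n\<close> variables. Affine space
  over the (infinite) fields considered here is irreducible, so nonempty open sets are dense.
\<close>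

definition for_general_linear_forms ::
    "nat \<Rightarrow> nat \<Rightarrow> ((nat \<times> nat \<Rightarrow> 'k::comm_ring_1) \<Rightarrow> bool) \<Rightarrow> bool"
  where "for_general_linear_forms n s Q \<longleftrightarrow>
    (\<exists>U. zariski_open ({1..s} \<times> {1..n}) U \<and> U \<noteq> {} \<and> (\<forall>a\<in>U. Q a))"

definition power_sum :: "nat \<Rightarrow> nat \<Rightarrow> nat \<Rightarrow> (nat \<times> nat \<Rightarrow> 'k) \<Rightarrow> (nat, 'k::comm_ring_1) mpoly"
  where "power_sum n d s a = (\<Sum>i=1..s. linear_form n a i ^ d)"

end

theory Submission
  imports Defs "Jordan_Normal_Form.Determinant" "HOL-Computational_Algebra.Primes"
begin

text \<open>
  Let \<open>a\<^sub>1, \<dots>, a\<^sub>s\<close> be the coefficient vectors of the linear forms. Since \<open>p \<circ> \<ell>\<^sub>j\<^sup>d\<close> is a multiple of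
  \<open>p(a\<^sub>j) \<ell>\<^sub>j\<^bsup>d-k\<^esup>\<close> for a form \<open>p\<close> of degree \<open>k \<le> d\<close>, such a \<open>p\<close> annihilates \<open>F = \<Sum>\<^sub>j \<ell>\<^sub>j\<^sup>d\<close> if and only if
  \<open>\<Sum>\<^sub>j p(a\<^sub>j) q(a\<^sub>j) = 0\<close> for all forms \<open>q\<close> of degree \<open>d - k\<close>
  (\<open>homogeneous_in_Ann_power_sum_iff\<close>). The graded pieces of the algebra are thus governed by a pairing
  of evaluations at the points \<open>a\<^sub>j\<close>.

  The variable \<open>x\<^sub>1\<close> is a Lefschetz element for general \<open>a\<close>. Multiplication by \<open>x\<^sub>1\<close> from degree \<open>i\<close> to degree
  \<open>i + 1\<close> and from degree \<open>d - 1 - i\<close> to degree \<open>d - i\<close> are dual to each other, so it is enough to show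
  injectivity for \<open>2 i < d\<close>. This follows once the symmetric form
  \<open>(p, p') \<mapsto> \<Sum>\<^sub>j a\<^sub>j\<^sub>1\<^bsup>d-2i\<^esup> p(a\<^sub>j) p'(a\<^sub>j)\<close>, which pairs \<open>x\<^sub>1 p\<close> with \<open>x\<^sub>1\<^bsup>d-1-2i\<^esup> p'\<close>, has only those forms \<open>p\<close> in
  its kernel that vanish at all the points. That is guaranteed by one nonvanishing determinant: if there are
  at most \<open>s\<close> monomials of degree \<open>i\<close>, take the Gram matrix of all of them; otherwise take that of \<open>s\<close>
  monomials, which by invertibility interpolate all values at the points. The same invertible matrix
  gives the surjectivity in the dual degree directly, by solving a linear system
  (\<open>lefschetz_frame_injective\<close>, \<open>lefschetz_frame_surjective\<close>).

  The determinants are polynomials in \<open>a\<close>, so the locus where none of them vanishes is Zariski open. To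
  see that it is not empty, take points whose coordinates are powers of distinct primes. The
  evaluation matrices become Vandermonde matrices with integer entries, and the Gram matrices, with positive
  weights, are positive definite over the reals (\<open>gram_exponential_nonsingular\<close>). Nonzero integers
  remain nonzero in a field of characteristic zero.
\<close>

section \<open>Linear functionals, evaluation and degree\<close>

lemma mpoly_induct [case_names single add]:
  fixes p :: "'a \<Rightarrow>\<^sub>0 'k::comm_monoid_add"
  assumes "\<And>m c. P (Poly_Mapping.single m c)"
    and "\<And>p q. P p \<Longrightarrow> P q \<Longrightarrow> P (p + q)"
  shows "P p"
proof -
  have sums: "P (\<Sum>m\<in>M. Poly_Mapping.single m (Poly_Mapping.lookup p m))" if "finite M" for M
    using that
  proof (induction M)
    case empty
    show ?case using assms(1)[of undefined 0] by simp
  qed (simp add: assms)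
  have "(\<Sum>m\<in>Poly_Mapping.keys p. Poly_Mapping.single m (Poly_Mapping.lookup p m)) = p"
    by (rule poly_mapping_eqI) (auto simp: lookup_sum lookup_single when_def in_keys_iff)
  then show ?thesis using sums[of "Poly_Mapping.keys p"] by simp
qed

text \<open>
  Evaluation at a point and pairing with an inverse system are both linear functionals given by their
  values on monomials, so what they have in common is proved once for this map.
\<close>

definition linear_extension :: "('a \<Rightarrow> 'k) \<Rightarrow> ('a \<Rightarrow>\<^sub>0 'k::comm_semiring_1) \<Rightarrow> 'k" where
  "linear_extension g p = (\<Sum>m\<in>Poly_Mapping.keys p. Poly_Mapping.lookup p m * g m)"

lemma linear_extension_superset:
  assumes "finite M" "Poly_Mapping.keys p \<subseteq> M"
  shows "linear_extension g p = (\<Sum>m\<in>M. Poly_Mapping.lookup p m * g m)"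
  unfolding linear_extension_def
  by (rule sum.mono_neutral_left) (use assms in \<open>auto simp: in_keys_iff\<close>)

lemma linear_extension_single [simp]:
  "linear_extension g (Poly_Mapping.single m c) = c * g m"
  by (simp add: linear_extension_def)

lemma linear_extension_add:
  "linear_extension g (p + q) = linear_extension g p + linear_extension g q"
proof -
  let ?M = "Poly_Mapping.keys p \<union> Poly_Mapping.keys q"
  have "finite ?M" "Poly_Mapping.keys (p + q) \<subseteq> ?M" by (simp_all add: keys_add)
  then show ?thesis
    by (simp add: linear_extension_superset[of ?M] lookup_add algebra_simps sum.distrib)
qed

lemma linear_extension_0 [simp]: "linear_extension g 0 = 0"
  by (simp add: linear_extension_def)

lemma linear_extension_uminus:
  fixes p :: "'a \<Rightarrow>\<^sub>0 'k::comm_ring_1"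
  shows "linear_extension g (- p) = - linear_extension g p"
  by (simp add: linear_extension_def sum_negf)

lemma linear_extension_diff:
  fixes p :: "'a \<Rightarrow>\<^sub>0 'k::comm_ring_1"
  shows "linear_extension g (p - q) = linear_extension g p - linear_extension g q"
  using linear_extension_add[of g p "- q"] by (simp add: linear_extension_uminus)

lemma linear_extension_cong:
  "(\<And>m. m \<in> Poly_Mapping.keys p \<Longrightarrow> g m = h m) \<Longrightarrow> linear_extension g p = linear_extension h p"
  by (simp add: linear_extension_def)

lemma linear_extension_fun_mult:
  "linear_extension (\<lambda>m. c * g m) p = c * linear_extension g p"
  by (simp add: linear_extension_def sum_distrib_left algebra_simps)

lemma linear_extension_fun_mult_right:
  "linear_extension (\<lambda>m. g m * c) p = linear_extension g p * c"
  by (simp add: linear_extension_def sum_distrib_right mult.assoc)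

lemma linear_extension_fun_sum:
  "linear_extension (\<lambda>m. \<Sum>j\<in>J. g j m) p = (\<Sum>j\<in>J. linear_extension (g j) p)"
  by (simp add: linear_extension_def sum_distrib_left sum.swap[of _ J])

text \<open>
  A product of polynomials pairs with \<open>g\<close> by letting one factor act on \<open>g\<close> by translation of
  exponents. With a multiplicative \<open>g\<close> this says that evaluation is multiplicative, and with the
  coefficients of a form as \<open>g\<close> that annihilators are closed under multiplication.
\<close>

lemma linear_extension_mult:
  fixes p q :: "'a::comm_monoid_add \<Rightarrow>\<^sub>0 'k::comm_semiring_1"
  shows "linear_extension g (p * q) = linear_extension (\<lambda>m. linear_extension (\<lambda>m'. g (m + m')) q) p"
proof (induction p rule: mpoly_induct)
  case (single m c)
  show ?case
  proof (induction q rule: mpoly_induct)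
    case (single m' c')
    show ?case by (simp add: mult_single mult.assoc)
  next
    case (add p q)
    then show ?case by (simp add: distrib_left linear_extension_add)
  qed
next
  case (add p q)
  then show ?case by (simp add: distrib_right linear_extension_add)
qed

definition monomial_value :: "('i \<Rightarrow> 'k::comm_semiring_1) \<Rightarrow> 'i monom \<Rightarrow> 'k" where
  "monomial_value a m = (\<Prod>i\<in>Poly_Mapping.keys m. a i ^ Poly_Mapping.lookup m i)"

lemma monomial_value_superset:
  assumes "finite J" "Poly_Mapping.keys m \<subseteq> J"
  shows "monomial_value a m = (\<Prod>i\<in>J. a i ^ Poly_Mapping.lookup m i)"
  unfolding monomial_value_def
  by (rule prod.mono_neutral_left) (use assms in \<open>auto simp: in_keys_iff\<close>)

lemma monomial_value_add: "monomial_value a (m + m') = monomial_value a m * monomial_value a m'"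
proof -
  let ?M = "Poly_Mapping.keys m \<union> Poly_Mapping.keys m'"
  have "finite ?M" "Poly_Mapping.keys (m + m') \<subseteq> ?M" by (simp_all add: keys_add)
  then show ?thesis
    by (simp add: monomial_value_superset[of ?M] lookup_add power_add prod.distrib)
qed

lemma monomial_value_0 [simp]: "monomial_value a 0 = 1"
  by (simp add: monomial_value_def)

lemma monomial_value_single [simp]: "monomial_value a (Poly_Mapping.single i k) = a i ^ k"
  by (simp add: monomial_value_def)

lemma eval_poly_eq: "eval_poly p a = linear_extension (monomial_value a) p"
  by (simp add: eval_poly_def linear_extension_def monomial_value_def)

lemma eval_poly_hom: "comm_ring_hom (\<lambda>p. eval_poly p a)"
proof
  show "eval_poly (p * q) a = eval_poly p a * eval_poly q a" for p q
    by (simp add: eval_poly_eq linear_extension_mult monomial_value_add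
        linear_extension_fun_mult linear_extension_fun_mult_right)
qed (simp_all add: eval_poly_eq linear_extension_add flip: single_one)

lemma eval_var_poly [simp]: "eval_poly (var_poly i) a = a i"
  by (simp add: eval_poly_eq var_poly_def)

lemma mono_degree_superset:
  assumes "finite J" "Poly_Mapping.keys m \<subseteq> J"
  shows "mono_degree m = (\<Sum>i\<in>J. Poly_Mapping.lookup m i)"
  unfolding mono_degree_def
  by (rule sum.mono_neutral_left) (use assms in \<open>auto simp: in_keys_iff\<close>)

lemma mono_degree_add: "mono_degree (m + m') = mono_degree m + mono_degree m'"
proof -
  let ?M = "Poly_Mapping.keys m \<union> Poly_Mapping.keys m'"
  have "finite ?M" "Poly_Mapping.keys (m + m') \<subseteq> ?M" by (simp_all add: keys_add)
  then show ?thesis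
    by (simp add: mono_degree_superset[of ?M] lookup_add sum.distrib)
qed

lemma mono_degree_single [simp]: "mono_degree (Poly_Mapping.single i k) = k"
  by (simp add: mono_degree_def)

lemma mono_degree_0 [simp]: "mono_degree 0 = 0"
  by (simp add: mono_degree_def)

lemma keys_add_nat:
  fixes m m' :: "'i monom"
  shows "Poly_Mapping.keys (m + m') = Poly_Mapping.keys m \<union> Poly_Mapping.keys m'"
  by (auto simp: in_keys_iff lookup_add)

section \<open>The polynomial ring\<close>

lemma polys_add: "p \<in> polys I \<Longrightarrow> q \<in> polys I \<Longrightarrow> p + q \<in> polys I"
  unfolding polys_def using keys_add[of p q] by blast

lemma polys_uminus: "p \<in> polys I \<Longrightarrow> - p \<in> polys I"
  by (simp add: polys_def)

lemma polys_mult: "p \<in> polys I \<Longrightarrow> q \<in> polys I \<Longrightarrow> p * q \<in> polys I"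
  unfolding polys_def using keys_mult[of p q] by (fastforce simp: keys_add_nat)

lemma polys_single: "Poly_Mapping.keys m \<subseteq> I \<Longrightarrow> Poly_Mapping.single m c \<in> polys I"
  by (simp add: polys_def)

lemma polys_0: "0 \<in> polys I" and polys_1: "1 \<in> polys I"
  by (simp_all add: polys_def)

lemma polys_sum: "(\<And>x. x \<in> X \<Longrightarrow> f x \<in> polys I) \<Longrightarrow> sum f X \<in> polys I"
  by (induction X rule: infinite_finite_induct) (auto intro: polys_add polys_0)

lemma polys_prod: "(\<And>x. x \<in> X \<Longrightarrow> f x \<in> polys I) \<Longrightarrow> prod f X \<in> polys I"
  by (induction X rule: infinite_finite_induct) (auto intro: polys_mult polys_1)

lemma polys_power: "p \<in> polys I \<Longrightarrow> p ^ k \<in> polys I"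
  by (induction k) (auto intro: polys_mult polys_1)

lemma polys_var: "i \<in> I \<Longrightarrow> var_poly i \<in> polys I"
  by (simp add: var_poly_def polys_single)

lemma homogeneous_add:
  "p \<in> homogeneous_polys I k \<Longrightarrow> q \<in> homogeneous_polys I k \<Longrightarrow> p + q \<in> homogeneous_polys I k"
  unfolding homogeneous_polys_def using keys_add[of p q] by (auto intro: polys_add)

lemma homogeneous_uminus:
  "p \<in> homogeneous_polys I k \<Longrightarrow> - p \<in> homogeneous_polys I k"
  unfolding homogeneous_polys_def by (auto intro: polys_uminus)

lemma homogeneous_diff:
  "p \<in> homogeneous_polys I k \<Longrightarrow> q \<in> homogeneous_polys I k \<Longrightarrow> p - q \<in> homogeneous_polys I k"
  using homogeneous_add[of p I k "- q"] by (simp add: homogeneous_uminus)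

lemma homogeneous_0: "0 \<in> homogeneous_polys I k"
  by (simp add: homogeneous_polys_def polys_0)

lemma homogeneous_sum:
  "(\<And>x. x \<in> X \<Longrightarrow> f x \<in> homogeneous_polys I k) \<Longrightarrow> sum f X \<in> homogeneous_polys I k"
  by (induction X rule: infinite_finite_induct) (auto intro: homogeneous_add homogeneous_0)

lemma homogeneous_mult:
  "p \<in> homogeneous_polys I k \<Longrightarrow> q \<in> homogeneous_polys I l \<Longrightarrow> p * q \<in> homogeneous_polys I (k + l)"
  unfolding homogeneous_polys_def using keys_mult[of p q]
  by (fastforce intro: polys_mult simp: mono_degree_add)

lemma homogeneous_single:
  "Poly_Mapping.keys m \<subseteq> I \<Longrightarrow> mono_degree m = k \<Longrightarrow> Poly_Mapping.single m c \<in> homogeneous_polys I k"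
  by (simp add: homogeneous_polys_def polys_single)

lemma homogeneous_var: "i \<in> I \<Longrightarrow> var_poly i \<in> homogeneous_polys I 1"
  by (simp add: var_poly_def homogeneous_single)

lemma cring_poly_ring: "cring (poly_ring I)"
proof (rule cringI)
  show "abelian_group (poly_ring I)"
  proof (rule abelian_groupI)
    fix p assume "p \<in> carrier (poly_ring I)"
    then show "\<exists>q\<in>carrier (poly_ring I). q \<oplus>\<^bsub>poly_ring I\<^esub> p = \<zero>\<^bsub>poly_ring I\<^esub>"
      by (intro bexI[of _ "- p"]) (simp_all add: poly_ring_def polys_uminus)
  qed (simp_all add: poly_ring_def polys_add polys_0 add_ac)
  show "Group.comm_monoid (poly_ring I)"
    by (rule comm_monoidI) (simp_all add: poly_ring_def polys_mult polys_1 mult_ac)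
qed (simp add: poly_ring_def distrib_right)

section \<open>Differentiation as contraction, and the annihilator ideal\<close>

definition mono_fact :: "'i monom \<Rightarrow> nat" where
  "mono_fact m = (\<Prod>i\<in>Poly_Mapping.keys m. fact (Poly_Mapping.lookup m i))"

text \<open>
  The coefficient of \<open>F\<close> at \<open>m\<close> in the basis of divided powers \<open>X\<^sup>m / m!\<close>. In this basis
  differentiation loses its integer factors and becomes a shift of exponents.
\<close>

definition divided_coeff :: "('i, 'k::comm_ring_1) mpoly \<Rightarrow> 'i monom \<Rightarrow> 'k" where
  "divided_coeff F m = of_nat (mono_fact m) * Poly_Mapping.lookup F m"

lemma mono_fact_superset:
  assumes "finite J" "Poly_Mapping.keys m \<subseteq> J"
  shows "mono_fact m = (\<Prod>i\<in>J. fact (Poly_Mapping.lookup m i))"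
  unfolding mono_fact_def
  by (rule prod.mono_neutral_left) (use assms in \<open>auto simp: in_keys_iff\<close>)

lemma mono_fact_add_var:
  "mono_fact (m + Poly_Mapping.single i 1) = (Poly_Mapping.lookup m i + 1) * mono_fact m"
proof -
  let ?J = "insert i (Poly_Mapping.keys m)"
  have "mono_fact (m + Poly_Mapping.single i 1)
      = (\<Prod>j\<in>?J. fact (Poly_Mapping.lookup (m + Poly_Mapping.single i 1) j))"
    by (rule mono_fact_superset) (auto simp: keys_add_nat)
  also have "\<dots> = fact (Poly_Mapping.lookup m i + 1)
      * (\<Prod>j\<in>?J - {i}. fact (Poly_Mapping.lookup (m + Poly_Mapping.single i 1) j))"
    by (subst prod.remove[of _ i]) (auto simp: lookup_add)
  also have "(\<Prod>j\<in>?J - {i}. fact (Poly_Mapping.lookup (m + Poly_Mapping.single i 1) j))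
      = (\<Prod>j\<in>?J - {i}. fact (Poly_Mapping.lookup m j) :: nat)"
    by (intro prod.cong) (auto simp: lookup_add lookup_single)
  also have "fact (Poly_Mapping.lookup m i + 1) * \<dots> = (Poly_Mapping.lookup m i + 1) *
      (fact (Poly_Mapping.lookup m i) * (\<Prod>j\<in>?J - {i}. fact (Poly_Mapping.lookup m j)))"
    by (simp add: algebra_simps)
  also have "fact (Poly_Mapping.lookup m i) * (\<Prod>j\<in>?J - {i}. fact (Poly_Mapping.lookup m j))
      = (\<Prod>j\<in>?J. fact (Poly_Mapping.lookup m j) :: nat)"
    by (subst (2) prod.remove[of _ i]) auto
  also have "\<dots> = mono_fact m"
    by (rule mono_fact_superset[symmetric]) auto
  finally show ?thesis .
qed

lemma mono_fact_pos: "mono_fact m > 0"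
  by (auto simp: mono_fact_def intro: prod_pos)

lemma divided_coeff_eq_0_iff:
  fixes F :: "('i, 'k::field_char_0) mpoly"
  shows "divided_coeff F m = 0 \<longleftrightarrow> Poly_Mapping.lookup F m = 0"
  using mono_fact_pos[of m] by (simp add: divided_coeff_def)

lemma lookup_partial_deriv:
  fixes F :: "('i, 'k::comm_ring_1) mpoly"
  shows "Poly_Mapping.lookup (partial_deriv i F) m
    = of_nat (Poly_Mapping.lookup m i + 1) * Poly_Mapping.lookup F (m + Poly_Mapping.single i 1)"
proof -
  let ?e = "Poly_Mapping.single i (1::nat)"
  have "Poly_Mapping.lookup (partial_deriv i F) m
      = (\<Sum>m'\<in>Poly_Mapping.keys F. of_nat (Poly_Mapping.lookup m' i) * Poly_Mapping.lookup F m'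
          when m' - ?e = m)"
    by (simp add: partial_deriv_def lookup_sum lookup_single)
  also have "\<dots> = (\<Sum>m'\<in>Poly_Mapping.keys F. of_nat (Poly_Mapping.lookup m' i) * Poly_Mapping.lookup F m'
          when m' = m + ?e)"
  proof (rule sum.cong)
    fix m' :: "'i monom"
    have "m' = m + ?e" if "m' - ?e = m" "Poly_Mapping.lookup m' i \<noteq> 0"
      by (rule poly_mapping_eqI)
         (use that in \<open>auto simp: lookup_add lookup_single lookup_minus when_def\<close>)
    then have "m' - ?e = m \<longleftrightarrow> m' = m + ?e" if "Poly_Mapping.lookup m' i \<noteq> 0"
      using that by (metis add_diff_cancel_right')
    then show "(of_nat (Poly_Mapping.lookup m' i) * Poly_Mapping.lookup F m' when m' - ?e = m)
        = (of_nat (Poly_Mapping.lookup m' i) * Poly_Mapping.lookup F m' when m' = m + ?e)"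
      by (cases "Poly_Mapping.lookup m' i = 0") simp_all
  qed simp
  also have "\<dots> = of_nat (Poly_Mapping.lookup m i + 1) * Poly_Mapping.lookup F (m + ?e)"
    by (simp add: when_def lookup_add in_keys_iff)
  finally show ?thesis .
qed

lemma divided_coeff_partial_deriv:
  "divided_coeff (partial_deriv i F) m = divided_coeff F (m + Poly_Mapping.single i 1)"
  by (simp add: divided_coeff_def lookup_partial_deriv mono_fact_add_var mult_ac del: One_nat_def)

lemma divided_coeff_partial_deriv_funpow:
  "divided_coeff ((partial_deriv i ^^ k) F) m = divided_coeff F (m + Poly_Mapping.single i k)"
  by (induction k arbitrary: m)
     (simp_all add: divided_coeff_partial_deriv add.assoc flip: single_add)

text \<open>
  One partial derivative shifts the exponent by one unit vector, so iterating over the variables of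
  \<open>m\<close>, in whatever order, shifts it by \<open>m\<close>.
\<close>

lemma divided_coeff_mono_deriv:
  "divided_coeff (mono_deriv m F) e = divided_coeff F (e + m)"
proof -
  have "divided_coeff (foldr (\<lambda>i. partial_deriv i ^^ f i) xs F) e
      = divided_coeff F (e + (\<Sum>i\<leftarrow>xs. Poly_Mapping.single i (f i)))" for f xs
    by (induction xs arbitrary: e)
       (simp_all add: divided_coeff_partial_deriv_funpow add.assoc)
  moreover have "(\<Sum>i\<leftarrow>sorted_list_of_set (Poly_Mapping.keys m).
      Poly_Mapping.single i (Poly_Mapping.lookup m i)) = m"
    by (rule poly_mapping_eqI)
       (auto simp: sum_list_distinct_conv_sum_set lookup_sum lookup_single when_def in_keys_iff)
  ultimately show ?thesis by (simp add: mono_deriv_def)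
qed

lemma lookup_const_poly_mult:
  "Poly_Mapping.lookup (const_poly c * F) m = c * Poly_Mapping.lookup F m"
proof (induction F rule: mpoly_induct)
  case (single m' c')
  show ?case by (simp add: const_poly_def mult_single lookup_single mult_when)
qed (simp add: distrib_left lookup_add)

lemma divided_coeff_sum: "divided_coeff (\<Sum>x\<in>X. f x) m = (\<Sum>x\<in>X. divided_coeff (f x) m)"
  by (simp add: divided_coeff_def lookup_sum sum_distrib_left)

lemma divided_coeff_const_mult: "divided_coeff (const_poly c * F) m = c * divided_coeff F m"
  by (simp add: divided_coeff_def lookup_const_poly_mult mult.left_commute)

lemma divided_coeff_diff_action:
  "divided_coeff (diff_action p F) e = linear_extension (\<lambda>m. divided_coeff F (e + m)) p"
  by (simp add: diff_action_def linear_extension_def divided_coeff_sum divided_coeff_const_mult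
      divided_coeff_mono_deriv)

text \<open>
  In characteristic zero the factors \<open>m!\<close> are invertible, so \<open>p \<circ> F = 0\<close> can be tested on divided
  coefficients.
\<close>

lemma Ann_iff:
  fixes F :: "('i::linorder, 'k::field_char_0) mpoly"
  shows "p \<in> Ann I F \<longleftrightarrow>
    p \<in> polys I \<and> (\<forall>e. linear_extension (\<lambda>m. divided_coeff F (e + m)) p = 0)"
  by (simp add: Ann_def divided_coeff_eq_0_iff poly_mapping_eq_iff fun_eq_iff
      flip: divided_coeff_diff_action)

lemma ideal_Ann:
  fixes F :: "('i::linorder, 'k::field_char_0) mpoly"
  shows "ideal (Ann I F) (poly_ring I)"
proof -
  interpret cring "poly_ring I" by (rule cring_poly_ring)
  have neg: "- p \<in> Ann I F" if "p \<in> Ann I F" for p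
    using that by (simp add: Ann_iff polys_uminus linear_extension_uminus)
  have minus: "\<ominus>\<^bsub>poly_ring I\<^esub> p = - p" if "p \<in> polys I" for p
    by (rule minus_equality) (use that in \<open>simp_all add: poly_ring_def polys_uminus\<close>)
  have mult: "q * p \<in> Ann I F" if p: "p \<in> Ann I F" and q: "q \<in> polys I" for p q
  proof -
    have "linear_extension (\<lambda>m. divided_coeff F (e + m)) (q * p)
        = linear_extension (\<lambda>m. 0) q" for e
      unfolding linear_extension_mult
      by (rule linear_extension_cong) (use p in \<open>simp add: Ann_iff add.assoc[symmetric]\<close>)
    then show ?thesis
      using p q by (simp add: Ann_iff polys_mult) (simp add: linear_extension_def)
  qed
  show ?thesis
  proof (rule idealI)
    show "ring (poly_ring I :: ('i, 'k) mpoly ring)"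
      by (rule cring.axioms(1)[OF cring_poly_ring])
    show "subgroup (Ann I F) (add_monoid (poly_ring I))"
    proof
      fix p assume p: "p \<in> Ann I F"
      then have "inv\<^bsub>add_monoid (poly_ring I)\<^esub> p = - p"
        using minus[of p] by (simp add: a_inv_def Ann_iff)
      then show "inv\<^bsub>add_monoid (poly_ring I)\<^esub> p \<in> Ann I F"
        using neg[OF p] by simp
    qed (auto simp: poly_ring_def Ann_iff polys_add polys_0 linear_extension_add)
  qed (use mult in \<open>auto simp: poly_ring_def mult.commute\<close>)
qed

lemma Ann_coset_eq_iff:
  fixes F :: "('i::linorder, 'k::field_char_0) mpoly"
  assumes "p \<in> polys I" "q \<in> polys I"
  shows "Ann I F +>\<^bsub>poly_ring I\<^esub> p = Ann I F +>\<^bsub>poly_ring I\<^esub> q \<longleftrightarrow> p - q \<in> Ann I F"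
proof -
  interpret ideal "Ann I F" "poly_ring I" by (rule ideal_Ann)
  have minus: "\<ominus>\<^bsub>poly_ring I\<^esub> q = - q"
    by (rule minus_equality) (use assms in \<open>simp_all add: poly_ring_def polys_uminus\<close>)
  have "p \<ominus>\<^bsub>poly_ring I\<^esub> q = p - q"
    using assms minus by (simp add: a_minus_def) (simp add: poly_ring_def)
  then show ?thesis
    using assms quotient_eq_iff_same_a_r_cos[OF ideal_Ann, of p q]
    by (simp add: poly_ring_def)
qed

section \<open>The annihilator of a sum of powers of linear forms\<close>

lemma mono_degree_eq_0_iff: "mono_degree m = 0 \<longleftrightarrow> m = 0"
  by (auto simp: mono_degree_def in_keys_iff poly_mapping_eq_iff fun_eq_iff)

lemma monom_minus_plus_var:
  assumes "Poly_Mapping.lookup m i \<noteq> (0::nat)"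
  shows "m - Poly_Mapping.single i 1 + Poly_Mapping.single i 1 = m"
  by (rule poly_mapping_eqI) (use assms in \<open>auto simp: lookup_add lookup_single lookup_minus when_def\<close>)

lemma divided_coeff_var_mult:
  fixes F :: "('i, 'k::comm_ring_1) mpoly"
  shows "divided_coeff (var_poly i * F) m
    = of_nat (Poly_Mapping.lookup m i) * divided_coeff F (m - Poly_Mapping.single i 1)"
proof (cases "Poly_Mapping.lookup m i = 0")
  case True
  have "m \<notin> Poly_Mapping.keys (var_poly i * F)"
  proof
    assume "m \<in> Poly_Mapping.keys (var_poly i * F)"
    then obtain b where "m = Poly_Mapping.single i 1 + b"
      using keys_mult[of "var_poly i" F] by (auto simp: var_poly_def)
    then show False using True by (simp add: lookup_add)
  qed
  then have "Poly_Mapping.lookup (var_poly i * F) m = 0"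
    by (simp add: in_keys_iff)
  with True show ?thesis by (simp add: divided_coeff_def)
next
  case False
  define m' where "m' = m - Poly_Mapping.single i 1"
  have m: "m = m' + Poly_Mapping.single i 1"
    using monom_minus_plus_var[OF False] by (simp add: m'_def)
  have "Poly_Mapping.lookup (var_poly i * F) (m' + Poly_Mapping.single i 1) = Poly_Mapping.lookup F m'"
  proof (induction F rule: mpoly_induct)
    case (single e c)
    show ?case
      by (simp add: var_poly_def mult_single lookup_single add.commute[of m'] when_def)
  qed (simp add: distrib_left lookup_add)
  then show ?thesis
    unfolding m by (simp add: divided_coeff_def mono_fact_add_var lookup_add mult_ac del: One_nat_def)
qed

text \<open>
  This is the multinomial theorem: the coefficient of \<open>X\<^sup>m\<close> in \<open>\<ell>\<^sup>d\<close> is \<open>d!/m!\<close> times the value of the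
  monomial at the coefficient vector of \<open>\<ell>\<close>. The induction step multiplies by \<open>\<ell>\<close>, which contributes
  \<open>\<Sum>\<^sub>i m\<^sub>i = d + 1\<close>.
\<close>

lemma divided_coeff_linear_form_power:
  fixes a :: "nat \<times> nat \<Rightarrow> 'k::field_char_0"
  shows "divided_coeff (linear_form n a j ^ d) m =
    (if Poly_Mapping.keys m \<subseteq> {1..n} \<and> mono_degree m = d
     then fact d * monomial_value (\<lambda>i. a (j, i)) m else 0)"
proof (induction d arbitrary: m)
  case 0
  show ?case
    by (auto simp: divided_coeff_def lookup_one mono_degree_eq_0_iff when_def mono_fact_def)
next
  case (Suc d)
  let ?a = "\<lambda>i. a (j, i)" and ?m = "Poly_Mapping.lookup m"
  have "divided_coeff (linear_form n a j ^ Suc d) m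
      = (\<Sum>i=1..n. ?a i * (of_nat (?m i) *
          divided_coeff (linear_form n a j ^ d) (m - Poly_Mapping.single i 1)))"
    by (simp add: linear_form_def[of n a j] sum_distrib_right divided_coeff_sum
        divided_coeff_const_mult divided_coeff_var_mult mult.assoc)
  also have "\<dots> = (\<Sum>i=1..n. if Poly_Mapping.keys m \<subseteq> {1..n} \<and> mono_degree m = Suc d
      then of_nat (?m i) * (fact d * monomial_value ?a m) else 0)"
  proof (rule sum.cong)
    fix i assume i: "i \<in> {1..n}"
    show "?a i * (of_nat (?m i) * divided_coeff (linear_form n a j ^ d) (m - Poly_Mapping.single i 1))
        = (if Poly_Mapping.keys m \<subseteq> {1..n} \<and> mono_degree m = Suc d
            then of_nat (?m i) * (fact d * monomial_value ?a m) else 0)"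
    proof (cases "?m i = 0")
      case False
      define m' where "m' = m - Poly_Mapping.single i 1"
      have m: "m = m' + Poly_Mapping.single i 1"
        using monom_minus_plus_var[OF False] by (simp add: m'_def)
      show ?thesis
        unfolding m using i
        by (simp add: Suc.IH keys_add_nat mono_degree_add monomial_value_add mult_ac del: One_nat_def)
    qed simp
  qed simp
  also have "\<dots> = (if Poly_Mapping.keys m \<subseteq> {1..n} \<and> mono_degree m = Suc d
      then fact (Suc d) * monomial_value ?a m else 0)"
  proof (cases "Poly_Mapping.keys m \<subseteq> {1..n} \<and> mono_degree m = Suc d")
    case True
    then have "(\<Sum>i=1..n. of_nat (?m i)) = (of_nat (Suc d) :: 'k)"
      using mono_degree_superset[of "{1..n}" m] by (simp flip: of_nat_sum)
    with True show ?thesis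
      by (simp add: sum_distrib_right[symmetric] mult.assoc)
  next
    case False
    show ?thesis by (simp only: if_not_P[OF False] sum.neutral_const)
  qed
  finally show ?case .
qed

lemma divided_coeff_power_sum:
  fixes a :: "nat \<times> nat \<Rightarrow> 'k::field_char_0"
  shows "divided_coeff (power_sum n d s a) m =
    (if Poly_Mapping.keys m \<subseteq> {1..n} \<and> mono_degree m = d
     then fact d * (\<Sum>j=1..s. monomial_value (\<lambda>i. a (j, i)) m) else 0)"
proof (cases "Poly_Mapping.keys m \<subseteq> {1..n} \<and> mono_degree m = d")
  case True
  then show ?thesis
    by (simp add: power_sum_def divided_coeff_sum divided_coeff_linear_form_power sum_distrib_left)
next
  case False
  show ?thesis
    by (simp only: power_sum_def divided_coeff_sum divided_coeff_linear_form_power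
        if_not_P[OF False] sum.neutral_const)
qed

lemma contraction_power_sum:
  fixes a :: "nat \<times> nat \<Rightarrow> 'k::field_char_0"
  assumes "p \<in> homogeneous_polys {1..n} k"
  shows "linear_extension (\<lambda>m. divided_coeff (power_sum n d s a) (e + m)) p =
    (if Poly_Mapping.keys e \<subseteq> {1..n} \<and> mono_degree e + k = d
     then fact d * (\<Sum>j=1..s. eval_poly p (\<lambda>i. a (j, i)) * monomial_value (\<lambda>i. a (j, i)) e) else 0)"
    (is "?L = ?R")
proof -
  let ?c = "Poly_Mapping.keys e \<subseteq> {1..n} \<and> mono_degree e + k = d"
  have "?L = linear_extension (\<lambda>m. if ?c then fact d *
      (\<Sum>j=1..s. monomial_value (\<lambda>i. a (j, i)) m * monomial_value (\<lambda>i. a (j, i)) e) else 0) p"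
    by (rule linear_extension_cong)
       (use assms in \<open>auto simp: homogeneous_polys_def polys_def divided_coeff_power_sum
          keys_add_nat mono_degree_add monomial_value_add mult.commute\<close>)
  also have "\<dots> = ?R"
  proof (cases ?c)
    case True
    then show ?thesis
      by (simp add: linear_extension_fun_mult linear_extension_fun_sum
          linear_extension_fun_mult_right eval_poly_eq)
  next
    case False
    show ?thesis by (simp only: if_not_P[OF False]) (simp add: linear_extension_def)
  qed
  finally show ?thesis .
qed

text \<open>
  Write \<open>a\<^sub>j\<close> for the coefficient vector of the \<open>j\<close>-th linear form. On forms of degree \<open>k\<close>, annihilating
  \<open>F\<close> means lying in the kernel of the pairing \<open>(p, q) \<mapsto> \<Sum>\<^sub>j p(a\<^sub>j) q(a\<^sub>j)\<close> with forms \<open>q\<close> of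
  complementary degree, of which only the monomials need to be tested. For \<open>k > d\<close> there are none.
\<close>

lemma homogeneous_in_Ann_power_sum_iff:
  fixes a :: "nat \<times> nat \<Rightarrow> 'k::field_char_0"
  assumes "p \<in> homogeneous_polys {1..n} k"
  shows "p \<in> Ann {1..n} (power_sum n d s a) \<longleftrightarrow>
    (\<forall>e. Poly_Mapping.keys e \<subseteq> {1..n} \<and> mono_degree e + k = d \<longrightarrow>
      (\<Sum>j=1..s. eval_poly p (\<lambda>i. a (j, i)) * monomial_value (\<lambda>i. a (j, i)) e) = 0)"
  using assms unfolding Ann_iff contraction_power_sum[OF assms]
  by (auto simp: homogeneous_polys_def)

section \<open>Gram determinants\<close>

lemma mat_mult_vec_nth:
  assumes "u < N"
  shows "(mat N N (\<lambda>(u, v). A u v) *\<^sub>v vec N x) $ u = (\<Sum>v<N. A u v * x v)"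
  using assms by (simp add: scalar_prod_def atLeast0LessThan)

lemma det_nonzero_iff_trivial_kernel:
  fixes A :: "nat \<Rightarrow> nat \<Rightarrow> 'k::field"
  shows "det (mat N N (\<lambda>(u, v). A u v)) \<noteq> 0 \<longleftrightarrow>
    (\<forall>x. (\<forall>u<N. (\<Sum>v<N. A u v * x v) = 0) \<longrightarrow> (\<forall>v<N. x v = 0))"
    (is "?L \<longleftrightarrow> ?R")
proof -
  let ?A = "mat N N (\<lambda>(u, v). A u v)"
  have zero: "?A *\<^sub>v vec N x = 0\<^sub>v N \<longleftrightarrow> (\<forall>u<N. (\<Sum>v<N. A u v * x v) = 0)" for x
    by (auto simp: vec_eq_iff mat_mult_vec_nth simp del: index_mult_mat_vec)
  have "?L \<longleftrightarrow> (\<forall>y\<in>carrier_vec N. ?A *\<^sub>v y = 0\<^sub>v N \<longrightarrow> y = 0\<^sub>v N)"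
    by (subst det_0_iff_vec_prod_zero[of _ N]) auto
  also have "\<dots> \<longleftrightarrow> (\<forall>x. ?A *\<^sub>v vec N x = 0\<^sub>v N \<longrightarrow> vec N x = 0\<^sub>v N)"
  proof -
    have "y = vec N (\<lambda>v. y $ v)" if "y \<in> carrier_vec N" for y :: "'k vec"
      using that by (intro eq_vecI) auto
    then show ?thesis by (metis vec_carrier)
  qed
  also have "\<dots> \<longleftrightarrow> ?R"
    unfolding zero by (simp add: vec_eq_iff)
  finally show ?thesis .
qed

lemma det_nonzero_imp_solvable:
  fixes A :: "nat \<Rightarrow> nat \<Rightarrow> 'k::field"
  assumes "det (mat N N (\<lambda>(u, v). A u v)) \<noteq> 0"
  shows "\<exists>x. \<forall>u<N. (\<Sum>v<N. A u v * x v) = c u"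
proof -
  let ?A = "mat N N (\<lambda>(u, v). A u v)"
  obtain B where B: "B \<in> carrier_mat N N" "?A * B = 1\<^sub>m N"
    using det_non_zero_imp_unit[OF mat_carrier assms] by (auto simp: Units_def ring_mat_def)
  let ?y = "B *\<^sub>v vec N c"
  have y: "vec N (\<lambda>v. ?y $ v) = ?y"
    using B(1) by (intro eq_vecI) auto
  have "?A *\<^sub>v ?y = vec N c"
    using B by (simp flip: assoc_mult_mat_vec[of ?A N N B N])
  then have "(?A *\<^sub>v vec N (\<lambda>v. ?y $ v)) $ u = c u" if "u < N" for u
    using that by (simp add: y del: index_mult_mat_vec)
  then show ?thesis
    by (metis mat_mult_vec_nth)
qed

text \<open>
  The matrix \<open>V\<^sup>T W V\<close> with \<open>V = (f j v)\<close> and \<open>W\<close> the diagonal matrix of the weights \<open>w j\<close>.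
\<close>

definition gram :: "'j set \<Rightarrow> ('j \<Rightarrow> 'k) \<Rightarrow> ('j \<Rightarrow> nat \<Rightarrow> 'k) \<Rightarrow> nat \<Rightarrow> 'k::comm_ring_1 mat" where
  "gram J w f N = mat N N (\<lambda>(u, v). \<Sum>j\<in>J. w j * f j u * f j v)"

lemma gram_row_sum:
  fixes x :: "nat \<Rightarrow> 'k::comm_ring_1"
  shows "(\<Sum>v<N. (\<Sum>j\<in>J. w j * f j u * f j v) * x v) = (\<Sum>j\<in>J. w j * f j u * (\<Sum>v<N. f j v * x v))"
  by (simp add: sum_distrib_left sum_distrib_right sum.swap[of _ J] mult.assoc)

lemma gram_nonsingular_iff:
  fixes w :: "'j \<Rightarrow> 'k::field"
  shows "det (gram J w f N) \<noteq> 0 \<longleftrightarrow>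
    (\<forall>x. (\<forall>u<N. (\<Sum>j\<in>J. w j * f j u * (\<Sum>v<N. f j v * x v)) = 0) \<longrightarrow> (\<forall>v<N. x v = 0))"
  unfolding gram_def det_nonzero_iff_trivial_kernel gram_row_sum ..

lemma gram_solvable:
  fixes w :: "'j \<Rightarrow> 'k::field"
  assumes "det (gram J w f N) \<noteq> 0"
  shows "\<exists>x. \<forall>u<N. (\<Sum>j\<in>J. w j * f j u * (\<Sum>v<N. f j v * x v)) = c u"
  using det_nonzero_imp_solvable[OF assms[unfolded gram_def], of c] unfolding gram_row_sum .

text \<open>
  If \<open>V\<^sup>T W V\<close> is invertible, then \<open>V\<close> is injective, and a square injective \<open>V\<close> is also surjective.
\<close>

lemma gram_interpolation:
  fixes w :: "'j \<Rightarrow> 'k::field"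
  assumes det: "det (gram J w f (card J)) \<noteq> 0" and "finite J"
  shows "\<exists>x. \<forall>j\<in>J. (\<Sum>v<card J. f j v * x v) = h j"
proof -
  obtain g where g: "bij_betw g {..<card J} J"
    using ex_bij_betw_nat_finite[OF \<open>finite J\<close>] by (auto simp: atLeast0LessThan)
  have hit: "\<exists>u<card J. j = g u" if "j \<in> J" for j
    using bij_betw_imp_surj_on[OF g] that by blast
  have "det (mat (card J) (card J) (\<lambda>(u, v). f (g u) v)) \<noteq> 0"
    unfolding det_nonzero_iff_trivial_kernel
  proof (intro allI impI)
    fix x v
    assume x: "\<forall>u<card J. (\<Sum>v<card J. f (g u) v * x v) = 0" and v: "v < card J"
    have "(\<Sum>v<card J. f j v * x v) = 0" if "j \<in> J" for j
      using x hit[OF that] by auto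
    then show "x v = 0"
      using det[unfolded gram_nonsingular_iff] v by simp
  qed
  from det_nonzero_imp_solvable[OF this, of "\<lambda>u. h (g u)"]
  obtain x where x: "\<forall>u<card J. (\<Sum>v<card J. f (g u) v * x v) = h (g u)" by blast
  have "(\<Sum>v<card J. f j v * x v) = h j" if "j \<in> J" for j
    using x hit[OF that] by auto
  then show ?thesis by blast
qed

lemma det_gram_hom:
  assumes "comm_ring_hom h"
  shows "h (det (gram J w f N)) = det (gram J (\<lambda>j. h (w j)) (\<lambda>j v. h (f j v)) N)"
proof -
  interpret comm_ring_hom h by (rule assms)
  have "map_mat h (gram J w f N) = gram J (\<lambda>j. h (w j)) (\<lambda>j v. h (f j v)) N"
    by (rule eq_matI) (simp_all add: gram_def hom_sum hom_mult)
  then show ?thesis by (metis hom_det)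
qed

lemma det_gram_in_polys:
  assumes "\<And>j. j \<in> J \<Longrightarrow> w j \<in> polys I" "\<And>j v. j \<in> J \<Longrightarrow> v < N \<Longrightarrow> f j v \<in> polys I"
  shows "det (gram J w f N) \<in> polys I"
proof -
  have "signof p \<in> polys I" for p :: "nat \<Rightarrow> nat"
    by (simp add: sign_def polys_1 polys_uminus)
  then show ?thesis
    unfolding det_def gram_def
    by (auto intro!: polys_sum polys_mult polys_prod assms dest: permutes_in_image)
qed

text \<open>
  A Vandermonde argument. Linear combinations of the hypotheses give \<open>\<Sum>\<^sub>v x\<^sub>v y\<^sub>v Q(y\<^sub>v) = 0\<close> for every
  polynomial \<open>Q\<close> of degree less than \<open>s\<close>. Taking for \<open>Q\<close> the polynomial that vanishes at all other
  nodes isolates a single \<open>x\<^sub>v\<close>.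
\<close>

lemma exponential_sums_independent:
  fixes y x :: "nat \<Rightarrow> 'k::idom"
  assumes "inj_on y {..<N}" "\<And>v. v < N \<Longrightarrow> y v \<noteq> 0" "N \<le> s"
    and zero: "\<And>j. j \<in> {1..s} \<Longrightarrow> (\<Sum>v<N. y v ^ j * x v) = 0"
    and v: "v < N"
  shows "x v = 0"
proof -
  define Q where "Q = (\<Prod>u\<in>{..<N} - {v}. [:- y u, 1:])"
  have "degree Q = N - 1"
    unfolding Q_def by (subst degree_prod_eq_sum_degree) (use v in auto)
  then have deg: "degree Q < s" using v \<open>N \<le> s\<close> by linarith
  have "(\<Sum>u<N. (y u * x u) * poly Q (y u))
      = (\<Sum>u<N. \<Sum>i\<le>degree Q. coeff Q i * (y u ^ Suc i * x u))"
    by (simp add: poly_altdef sum_distrib_left mult_ac)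
  also have "\<dots> = (\<Sum>i\<le>degree Q. coeff Q i * (\<Sum>u<N. y u ^ Suc i * x u))"
    by (subst sum.swap) (simp add: sum_distrib_left)
  also have "\<dots> = 0"
    by (intro sum.neutral ballI) (use deg zero[of "Suc _"] in simp)
  finally have "(\<Sum>u<N. (y u * x u) * poly Q (y u)) = 0" .
  moreover have "poly Q (y u) = 0" if "u < N" "u \<noteq> v" for u
    using that by (auto simp: Q_def poly_prod prod_zero_iff)
  then have "(\<Sum>u<N. (y u * x u) * poly Q (y u)) = (y v * x v) * poly Q (y v)"
    by (subst sum.remove[of _ v]) (use v in auto)
  moreover have "poly Q (y v) \<noteq> 0"
    using assms(1) v by (auto simp: Q_def poly_prod inj_on_def)
  ultimately show "x v = 0" using assms(2)[OF v] by simp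
qed

text \<open>
  Over the reals \<open>V\<^sup>T W V\<close> with positive weights is positive definite as soon as \<open>V\<close> is injective, which
  for \<open>V = (y\<^sub>v\<^sup>j)\<close> is the Vandermonde argument. The field at hand need not be ordered, but the entries
  are integers: the determinant is a nonzero integer, and stays nonzero in characteristic zero.
\<close>

lemma gram_exponential_nonsingular:
  fixes y :: "nat \<Rightarrow> int" and w :: "nat \<Rightarrow> int"
  assumes y: "inj_on y {..<N}" "\<And>v. v < N \<Longrightarrow> y v \<noteq> 0" and "N \<le> s"
    and w: "\<And>j. j \<in> {1..s} \<Longrightarrow> w j > 0"
  shows "det (gram {1..s} (\<lambda>j. of_int (w j)) (\<lambda>j v. of_int (y v ^ j)) N) \<noteq> (0::'k::field_char_0)"
proof -
  let ?r = "real_of_int"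
  have "det (gram {1..s} (\<lambda>j. ?r (w j)) (\<lambda>j v. ?r (y v ^ j)) N) \<noteq> 0"
    unfolding gram_nonsingular_iff
  proof (intro allI impI)
    fix x v
    define z where "z j = (\<Sum>v<N. ?r (y v ^ j) * x v)" for j
    assume "\<forall>u<N. (\<Sum>j=1..s. ?r (w j) * ?r (y u ^ j) * (\<Sum>v<N. ?r (y v ^ j) * x v)) = 0"
      and v: "v < N"
    then have "0 = (\<Sum>u<N. x u * (\<Sum>j=1..s. ?r (w j) * ?r (y u ^ j) * z j))"
      by (simp add: z_def)
    also have "\<dots> = (\<Sum>j=1..s. \<Sum>u<N. ?r (w j) * z j * (?r (y u ^ j) * x u))"
      by (subst sum.swap) (simp add: sum_distrib_left mult_ac)
    also have "\<dots> = (\<Sum>j=1..s. ?r (w j) * z j * z j)"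
      by (simp add: z_def flip: sum_distrib_left)
    \<comment> \<open>A kernel vector has \<open>x\<^sup>T V\<^sup>T W V x = 0\<close>, a sum of nonnegative terms.\<close>
    finally have "\<forall>j\<in>{1..s}. ?r (w j) * z j * z j = 0"
      using w by (subst (asm) eq_commute, subst (asm) sum_nonneg_eq_0_iff)
        (auto simp: mult.assoc less_imp_le)
    then have "?r (w j) * z j * z j = 0" if "j \<in> {1..s}" for j
      using that by blast
    then have "z j = 0" if "j \<in> {1..s}" for j
      using w[OF that] that by (metis less_irrefl mult_eq_0_iff of_int_eq_0_iff)
    then show "x v = 0"
      using exponential_sums_independent[of "\<lambda>v. ?r (y v)" N s x v] assms v
      by (simp add: z_def inj_on_def)
  qed
  then have "?r (det (gram {1..s} w (\<lambda>j v. y v ^ j) N)) \<noteq> 0"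
    by (simp add: det_gram_hom[OF of_int_hom.comm_ring_hom_axioms])
  then have "(of_int (det (gram {1..s} w (\<lambda>j v. y v ^ j) N)) :: 'k) \<noteq> 0"
    by simp
  then show ?thesis
    unfolding det_gram_hom[OF of_int_hom.comm_ring_hom_axioms] .
qed

section \<open>Multiplication by a variable when the Gram determinants do not vanish\<close>

text \<open>
  The matrix is the Gram matrix, on the monomials \<open>ms\<close> of degree \<open>k\<close>, of the pairing
  \<open>(p, p') \<mapsto> \<Sum>\<^sub>j a\<^sub>j\<^sub>1\<^bsup>d-2k\<^esup> p(a\<^sub>j) p'(a\<^sub>j)\<close>. The exponent is the one for which this is the pairing of \<open>x\<^sub>1 p\<close>
  with \<open>x\<^sub>1\<^bsup>d-1-2k\<^esup> p'\<close>, whose degrees add up to \<open>d\<close>. Either all monomials are used or exactly \<open>s\<close> of them.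
\<close>

definition lefschetz_frame ::
    "nat \<Rightarrow> nat \<Rightarrow> nat \<Rightarrow> (nat \<times> nat \<Rightarrow> 'k::field_char_0) \<Rightarrow> nat \<Rightarrow> nat monom list \<Rightarrow> bool" where
  "lefschetz_frame n d s a k ms \<longleftrightarrow>
    distinct ms \<and> set ms \<subseteq> {m. Poly_Mapping.keys m \<subseteq> {1..n} \<and> mono_degree m = k} \<and>
    (set ms = {m. Poly_Mapping.keys m \<subseteq> {1..n} \<and> mono_degree m = k} \<or> length ms = s) \<and>
    det (gram {1..s} (\<lambda>j. a (j, 1) ^ (d - 2 * k))
      (\<lambda>j v. monomial_value (\<lambda>i. a (j, i)) (ms ! v)) (length ms)) \<noteq> 0"

text \<open>
  As functions on the points \<open>a\<^sub>1, \<dots>, a\<^sub>s\<close>, all forms of degree \<open>k\<close> are combinations of the listed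
  monomials: either every monomial is listed, or there are \<open>s\<close> of them and these already interpolate
  arbitrary values at the \<open>s\<close> points.
\<close>

lemma lefschetz_frame_values:
  assumes frame: "lefschetz_frame n d s a k ms" and p: "p \<in> homogeneous_polys {1..n} k"
  shows "\<exists>x. \<forall>j\<in>{1..s}. eval_poly p (\<lambda>i. a (j, i))
    = (\<Sum>v<length ms. monomial_value (\<lambda>i. a (j, i)) (ms ! v) * x v)"
proof (cases "set ms = {m. Poly_Mapping.keys m \<subseteq> {1..n} \<and> mono_degree m = k}")
  case True
  then have keys: "Poly_Mapping.keys p \<subseteq> set ms"
    using p by (auto simp: homogeneous_polys_def polys_def)
  have bij: "bij_betw ((!) ms) {..<length ms} (set ms)"
    using frame by (intro bij_betw_nth) (auto simp: lefschetz_frame_def)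
  have "eval_poly p b = (\<Sum>v<length ms. monomial_value b (ms ! v) * Poly_Mapping.lookup p (ms ! v))" for b
    unfolding eval_poly_eq linear_extension_superset[OF finite_set keys]
    by (subst sum.reindex_bij_betw[OF bij, symmetric]) (simp add: mult.commute)
  then show ?thesis by (intro exI[of _ "\<lambda>v. Poly_Mapping.lookup p (ms ! v)"] ballI)
next
  case False
  then have "length ms = card {1..s}"
    using frame by (simp add: lefschetz_frame_def)
  then obtain x where "\<forall>j\<in>{1..s}. (\<Sum>v<length ms. monomial_value (\<lambda>i. a (j, i)) (ms ! v) * x v)
      = eval_poly p (\<lambda>i. a (j, i))"
    using gram_interpolation[of "{1..s}" "\<lambda>j. a (j, 1) ^ (d - 2 * k)"
        "\<lambda>j v. monomial_value (\<lambda>i. a (j, i)) (ms ! v)" "\<lambda>j. eval_poly p (\<lambda>i. a (j, i))"] frame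
    by (auto simp: lefschetz_frame_def)
  then show ?thesis by (intro exI[of _ x]) simp
qed

lemma eval_poly_mult: "eval_poly (p * q) a = eval_poly p a * eval_poly q a"
proof -
  interpret comm_ring_hom "\<lambda>p. eval_poly p a" by (rule eval_poly_hom)
  show ?thesis by (rule hom_mult)
qed

lemma power_weight:
  fixes b :: "'k::monoid_mult"
  assumes "2 * k < d"
  shows "b ^ (d - 2 * k) = b * b ^ (d - 1 - 2 * k)"
  unfolding power_Suc[symmetric] by (rule arg_cong[where f = "\<lambda>r. b ^ r"]) (use assms in simp)

text \<open>
  If \<open>x\<^sub>1 p\<close> annihilates \<open>F\<close>, testing it against \<open>x\<^sub>1\<^bsup>d-1-2k\<^esup>\<close> times the listed monomials puts the coordinates of
  the values of \<open>p\<close> into the kernel of the Gram matrix. So \<open>p\<close> vanishes at all the points, and in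
  particular \<open>p\<close> annihilates \<open>F\<close>.
\<close>

lemma lefschetz_frame_injective:
  assumes frame: "lefschetz_frame n d s a k ms" and "1 \<le> n" "2 * k < d"
    and p: "p \<in> homogeneous_polys {1..n} k"
    and Ann: "var_poly 1 * p \<in> Ann {1..n} (power_sum n d s a)"
    and j: "j \<in> {1..s}"
  shows "eval_poly p (\<lambda>i. a (j, i)) = 0"
proof -
  let ?f = "\<lambda>j v. monomial_value (\<lambda>i. a (j, i)) (ms ! v)"
  obtain x where x: "\<And>j. j \<in> {1..s} \<Longrightarrow> eval_poly p (\<lambda>i. a (j, i)) = (\<Sum>v<length ms. ?f j v * x v)"
    using lefschetz_frame_values[OF frame p] by blast
  have hom: "var_poly 1 * p \<in> homogeneous_polys {1..n} (1 + k)"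
    by (intro homogeneous_mult homogeneous_var p) (use \<open>1 \<le> n\<close> in simp)
  have "(\<Sum>j=1..s. a (j, 1) ^ (d - 2 * k) * ?f j u * (\<Sum>v<length ms. ?f j v * x v)) = 0"
    if u: "u < length ms" for u
  proof -
    let ?e = "Poly_Mapping.single 1 (d - 1 - 2 * k) + ms ! u"
    have "ms ! u \<in> set ms" using u by simp
    then have "Poly_Mapping.keys ?e \<subseteq> {1..n} \<and> mono_degree ?e + (1 + k) = d"
      using frame \<open>1 \<le> n\<close> \<open>2 * k < d\<close>
      by (auto simp: lefschetz_frame_def keys_add_nat mono_degree_add split: if_splits)
    then have "(\<Sum>j=1..s. eval_poly (var_poly 1 * p) (\<lambda>i. a (j, i)) * monomial_value (\<lambda>i. a (j, i)) ?e) = 0"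
      using Ann unfolding homogeneous_in_Ann_power_sum_iff[OF hom] by blast
    moreover have weight: "a (j, 1) ^ (d - 2 * k) = a (j, 1) * a (j, 1) ^ (d - 1 - 2 * k)" for j
      by (rule power_weight[OF \<open>2 * k < d\<close>])
    have "(\<Sum>j=1..s. a (j, 1) ^ (d - 2 * k) * ?f j u * (\<Sum>v<length ms. ?f j v * x v))
        = (\<Sum>j=1..s. eval_poly (var_poly 1 * p) (\<lambda>i. a (j, i)) * monomial_value (\<lambda>i. a (j, i)) ?e)"
      unfolding weight
      by (rule sum.cong) (simp_all add: eval_poly_mult monomial_value_add x)
    ultimately show ?thesis by simp
  qed
  then have "\<forall>v<length ms. x v = 0"
    using frame unfolding lefschetz_frame_def gram_nonsingular_iff by blast
  then show ?thesis using x[OF j] by simp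
qed

text \<open>
  This is dual to injectivity in degree \<open>k\<close>. Modulo the annihilator, a form of degree \<open>d - k\<close> is the
  functional it induces on forms of degree \<open>k\<close>, hence it is determined by its pairing with the listed
  monomials. Solving the linear system with the Gram matrix produces a multiple of \<open>x\<^sub>1\<close> that has the same
  pairings.
\<close>

lemma lefschetz_frame_surjective:
  assumes frame: "lefschetz_frame n d s a k ms" and "1 \<le> n" "2 * k < d"
    and g: "g \<in> homogeneous_polys {1..n} (d - k)"
  shows "\<exists>p\<in>homogeneous_polys {1..n} (d - 1 - k).
    g - var_poly 1 * p \<in> Ann {1..n} (power_sum n d s a)"
proof -
  let ?b = "\<lambda>j i. a (j, i)" and ?N = "length ms"
  let ?f = "\<lambda>j v. monomial_value (?b j) (ms ! v)"
  obtain x where x: "\<And>u. u < ?N \<Longrightarrow>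
      (\<Sum>j=1..s. a (j, 1) ^ (d - 2 * k) * ?f j u * (\<Sum>v<?N. ?f j v * x v))
        = (\<Sum>j=1..s. eval_poly g (?b j) * ?f j u)"
    using gram_solvable[of "{1..s}" "\<lambda>j. a (j, 1) ^ (d - 2 * k)" ?f ?N
        "\<lambda>u. \<Sum>j=1..s. eval_poly g (?b j) * ?f j u"] frame
    unfolding lefschetz_frame_def by blast
  let ?e = "\<lambda>v. Poly_Mapping.single 1 (d - 1 - 2 * k) + ms ! v"
  \<comment> \<open>The extra power of \<open>x\<^sub>1\<close> brings the monomials from degree \<open>k\<close> to degree \<open>d - 1 - k\<close>.\<close>
  define p where "p = (\<Sum>v<?N. Poly_Mapping.single (?e v) (x v))"
  have "Poly_Mapping.keys (?e v) \<subseteq> {1..n}" "mono_degree (?e v) = d - 1 - k" if "v < ?N" for v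
  proof -
    have "ms ! v \<in> set ms" using that by simp
    then show "Poly_Mapping.keys (?e v) \<subseteq> {1..n}" "mono_degree (?e v) = d - 1 - k"
      using frame \<open>1 \<le> n\<close> \<open>2 * k < d\<close>
      by (auto simp: lefschetz_frame_def keys_add_nat mono_degree_add split: if_splits)
  qed
  then have p: "p \<in> homogeneous_polys {1..n} (d - 1 - k)"
    unfolding p_def by (intro homogeneous_sum homogeneous_single) auto
  have "var_poly 1 * p \<in> homogeneous_polys {1..n} (1 + (d - 1 - k))"
    by (intro homogeneous_mult homogeneous_var p) (use \<open>1 \<le> n\<close> in simp)
  moreover have "1 + (d - 1 - k) = d - k" using \<open>2 * k < d\<close> by simp
  ultimately have hom: "g - var_poly 1 * p \<in> homogeneous_polys {1..n} (d - k)"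
    using g by (auto intro: homogeneous_diff)
  have lin_sum: "linear_extension h (\<Sum>v\<in>V. q v) = (\<Sum>v\<in>V. linear_extension h (q v))"
    for h and q :: "nat \<Rightarrow> (nat, 'a) mpoly" and V
    by (induction V rule: infinite_finite_induct) (simp_all add: linear_extension_add)
  have weight: "a (j, 1) ^ (d - 2 * k) = a (j, 1) * a (j, 1) ^ (d - 1 - 2 * k)" for j
    by (rule power_weight[OF \<open>2 * k < d\<close>])
  have p_value: "eval_poly (var_poly 1 * p) (?b j)
      = a (j, 1) ^ (d - 2 * k) * (\<Sum>v<?N. ?f j v * x v)" for j
    unfolding weight p_def eval_poly_mult
    by (simp add: eval_poly_eq[of "sum _ _"] lin_sum monomial_value_add sum_distrib_left mult_ac)
  have "(\<Sum>j=1..s. eval_poly (g - var_poly 1 * p) (?b j) * monomial_value (?b j) e) = 0"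
    if "Poly_Mapping.keys e \<subseteq> {1..n} \<and> mono_degree e + (d - k) = d" for e
  proof -
    have "mono_degree e = k" using that \<open>2 * k < d\<close> by linarith
    then have "Poly_Mapping.single e 1 \<in> homogeneous_polys {1..n} k"
      using that by (intro homogeneous_single) auto
    from lefschetz_frame_values[OF frame this]
    obtain y where y: "\<And>j. j \<in> {1..s} \<Longrightarrow> monomial_value (?b j) e = (\<Sum>u<?N. ?f j u * y u)"
      by (auto simp: eval_poly_eq)
    have expand: "(G - W * S) * (\<Sum>u<?N. h u * y u) = (\<Sum>u<?N. y u * (G * h u - W * h u * S))"
      for G W S :: 'a and h
      by (simp add: sum_distrib_left algebra_simps)
    have "(\<Sum>j=1..s. eval_poly (g - var_poly 1 * p) (?b j) * monomial_value (?b j) e)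
        = (\<Sum>j=1..s. (eval_poly g (?b j) - eval_poly (var_poly 1 * p) (?b j)) * (\<Sum>u<?N. ?f j u * y u))"
      by (rule sum.cong) (simp_all add: y eval_poly_eq linear_extension_diff)
    also have "\<dots> = (\<Sum>u<?N. y u * ((\<Sum>j=1..s. eval_poly g (?b j) * ?f j u)
        - (\<Sum>j=1..s. a (j, 1) ^ (d - 2 * k) * ?f j u * (\<Sum>v<?N. ?f j v * x v))))"
      unfolding p_value expand
      by (subst sum.swap) (simp only: sum_subtractf[symmetric] sum_distrib_left)
    also have "\<dots> = 0"
      by (intro sum.neutral ballI) (use x in simp)
    finally show ?thesis .
  qed
  then have "g - var_poly 1 * p \<in> Ann {1..n} (power_sum n d s a)"
    unfolding homogeneous_in_Ann_power_sum_iff[OF hom] by blast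
  with p show ?thesis by blast
qed

text \<open>
  If \<open>F = 0\<close>, then \<open>x\<^sub>1\<close> annihilates \<open>F\<close>, and injectivity in degree \<open>0\<close> would make the polynomial \<open>1\<close>
  vanish at \<open>a\<^sub>1\<close>.
\<close>

lemma power_sum_nonzero:
  assumes frame: "lefschetz_frame n d s a 0 ms" and "1 \<le> n" "1 \<le> d" "1 \<le> s"
  shows "power_sum n d s a \<noteq> 0"
proof
  assume "power_sum n d s a = 0"
  then have "var_poly 1 * 1 \<in> Ann {1..n} (power_sum n d s a)"
    using \<open>1 \<le> n\<close> by (simp add: Ann_iff divided_coeff_def polys_var) (simp add: linear_extension_def)
  moreover have "1 \<in> homogeneous_polys {1..n} 0"
    using homogeneous_single[of 0 "{1..n}" 0 1] by simp
  ultimately have "eval_poly 1 (\<lambda>i. a (1, i)) = 0"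
    using lefschetz_frame_injective[OF frame, of 1 1] assms by simp
  then show False by (simp add: eval_poly_eq flip: single_one)
qed

text \<open>
  The linear form is \<open>x\<^sub>1\<close>. A frame in degree \<open>k\<close> serves two maps: it makes multiplication out of degree
  \<open>k\<close> injective and multiplication into degree \<open>d - k\<close> surjective. As \<open>k\<close> runs through the numbers below
  \<open>d/2\<close>, these are all the maps between degrees up to \<open>d\<close>, beyond which the algebra vanishes.
\<close>

lemma lefschetz_frames_imp_weak_lefschetz:
  assumes frames: "\<And>k. 2 * k < d \<Longrightarrow> \<exists>ms. lefschetz_frame n d s a k ms" and "1 \<le> n"
  shows "weak_lefschetz (macaulay_algebra {1..n} (power_sum n d s a))
    (macaulay_component {1..n} (power_sum n d s a))"
proof -
  let ?F = "power_sum n d s a" and ?H = "homogeneous_polys {1..n}"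
  let ?C = "macaulay_component {1..n} ?F"
  define cos where "cos p = Ann {1..n} ?F +>\<^bsub>poly_ring {1..n}\<^esub> p" for p
  have comp: "?C k = cos ` ?H k" for k
    by (simp add: macaulay_component_def cos_def)
  have poly: "p \<in> polys {1..n}" if "p \<in> ?H k" for p :: "(nat, 'a) mpoly" and k
    using that by (simp add: homogeneous_polys_def)
  have cos_eq: "cos p = cos q \<longleftrightarrow> p - q \<in> Ann {1..n} ?F" if "p \<in> ?H k" "q \<in> ?H k" for p q k
    unfolding cos_def by (intro Ann_coset_eq_iff poly[OF that(1)] poly[OF that(2)])
  define x1 :: "(nat, 'a) mpoly" where "x1 = var_poly 1"
  have var: "x1 \<in> ?H 1"
    unfolding x1_def by (rule homogeneous_var) (use \<open>1 \<le> n\<close> in simp)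
  have mult: "cos (x1) \<otimes>\<^bsub>macaulay_algebra {1..n} ?F\<^esub> cos p = cos (x1 * p)"
    if "p \<in> ?H k" for p k
    using ideal.rcoset_mult_add[OF ideal_Ann, of "x1" "{1..n}" p ?F] poly[OF that] poly[OF var]
    by (simp add: macaulay_algebra_def FactRing_def cos_def poly_ring_def)
  have up: "x1 * p \<in> ?H (k + 1)" if "p \<in> ?H k" for p :: "(nat, 'a) mpoly" and k
    using homogeneous_mult[OF var that] by simp
  show ?thesis
    unfolding weak_lefschetz_def
  proof (intro bexI allI)
    show "cos (x1) \<in> ?C 1"
      unfolding comp using var by (rule imageI)
    fix i
    let ?mult = "\<lambda>x. cos (x1) \<otimes>\<^bsub>macaulay_algebra {1..n} ?F\<^esub> x"
    show "inj_on ?mult (?C i) \<or> ?mult ` ?C i = ?C (i + 1)"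
    proof (cases "2 * i < d")
      case True
      obtain ms where frame: "lefschetz_frame n d s a i ms" using frames[OF True] by blast
      have "cos p = cos q" if pq: "p \<in> ?H i" "q \<in> ?H i" and eq: "?mult (cos p) = ?mult (cos q)" for p q
      proof -
        have hom: "p - q \<in> ?H i" using pq by (rule homogeneous_diff)
        have "x1 * (p - q) \<in> Ann {1..n} ?F"
          using eq unfolding mult[OF pq(1)] mult[OF pq(2)] cos_eq[OF up[OF pq(1)] up[OF pq(2)]]
          by (simp add: right_diff_distrib)
        then have "\<forall>j\<in>{1..s}. eval_poly (p - q) (\<lambda>i. a (j, i)) = 0"
          using lefschetz_frame_injective[OF frame \<open>1 \<le> n\<close> True hom] unfolding x1_def by blast
        then have "p - q \<in> Ann {1..n} ?F"
          unfolding homogeneous_in_Ann_power_sum_iff[OF hom] by simp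
        then show ?thesis unfolding cos_eq[OF pq] .
      qed
      then have "inj_on ?mult (?C i)" unfolding comp inj_on_def by blast
      then show ?thesis ..
    next
      case False
      have lift: "\<exists>p\<in>?H i. g - x1 * p \<in> Ann {1..n} ?F" if g: "g \<in> ?H (i + 1)" for g
      proof (cases "i < d")
        case True
        \<comment> \<open>The dual degree, which lies below \<open>d/2\<close> because \<open>i\<close> does not.\<close>
        define k where "k = d - 1 - i"
        have k: "2 * k < d" "d - k = i + 1" "d - 1 - k = i" using True False by (auto simp: k_def)
        obtain ms where "lefschetz_frame n d s a k ms" using frames[OF k(1)] by blast
        from lefschetz_frame_surjective[OF this \<open>1 \<le> n\<close> k(1), unfolded k(2,3), OF g]
        show ?thesis unfolding x1_def .
      next
        case False
        then have "g - x1 * 0 \<in> Ann {1..n} ?F"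
          unfolding mult_zero_right diff_zero homogeneous_in_Ann_power_sum_iff[OF g] by simp
        then show ?thesis by (rule bexI[where x = 0]) (rule homogeneous_0)
      qed
      have "?mult ` ?C i = ?C (i + 1)"
      proof
        show "?mult ` ?C i \<subseteq> ?C (i + 1)"
        proof
          fix c assume "c \<in> ?mult ` ?C i"
          then obtain p where p: "p \<in> ?H i" "c = ?mult (cos p)" unfolding comp by blast
          show "c \<in> ?C (i + 1)"
            unfolding p(2) mult[OF p(1)] comp using up[OF p(1)] by (rule imageI)
        qed
        show "?C (i + 1) \<subseteq> ?mult ` ?C i"
        proof
          fix c assume "c \<in> ?C (i + 1)"
          then obtain g where g: "g \<in> ?H (i + 1)" "c = cos g" unfolding comp by blast
          obtain p where p: "p \<in> ?H i" "g - x1 * p \<in> Ann {1..n} ?F" using lift[OF g(1)] by blast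
          then have "c = ?mult (cos p)"
            unfolding g(2) mult[OF p(1)] cos_eq[OF g(1) up[OF p(1)]] by simp
          then show "c \<in> ?mult ` ?C i" using p(1) unfolding comp by blast
        qed
      qed
      then show ?thesis ..
    qed
  qed
qed

section \<open>Nonvanishing of the Gram determinants for general linear forms\<close>

lemma ex_exhaustive_or_full_list:
  "\<exists>ms. distinct ms \<and> set ms \<subseteq> M \<and> length ms \<le> s \<and> (set ms = M \<or> length ms = s)"
proof (cases "finite M \<and> card M \<le> s")
  case True
  then obtain ms where "set ms = M" "distinct ms" using finite_distinct_list by blast
  with True show ?thesis by (intro exI[of _ ms]) (auto simp flip: distinct_card)
next
  case False
  then obtain T where "T \<subseteq> M" "finite T" "card T = s"
    using infinite_arbitrarily_large[of M s] obtain_subset_with_card_n[of s M] by (metis nat_le_linear)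
  moreover obtain ms where "set ms = T" "distinct ms" using finite_distinct_list[OF \<open>finite T\<close>] by blast
  ultimately show ?thesis by (intro exI[of _ ms]) (auto simp flip: distinct_card)
qed

lemma gram_cong:
  assumes "\<And>j. j \<in> J \<Longrightarrow> w j = w' j" "\<And>j v. j \<in> J \<Longrightarrow> v < N \<Longrightarrow> f j v = f' j v"
  shows "gram J w f N = gram J w' f' N"
  unfolding gram_def by (rule eq_matI) (simp_all add: assms cong: sum.cong)

text \<open>
  Unique factorization of natural numbers.
\<close>

lemma monomial_value_primes_inj:
  assumes P: "inj P" "\<And>i. prime (P i :: nat)"
  shows "inj (monomial_value P)"
proof (rule injI)
  have "multiplicity (P i) (monomial_value P m) = Poly_Mapping.lookup m i" for m i
  proof -
    have "monomial_value P m = (\<Prod>p\<in>P ` Poly_Mapping.keys m. p ^ Poly_Mapping.lookup m (inv_into UNIV P p))"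
      unfolding monomial_value_def
      by (subst prod.reindex) (use P(1) in \<open>auto simp: inj_on_def\<close>)
    also have "multiplicity (P i) \<dots> = (if P i \<in> P ` Poly_Mapping.keys m
        then Poly_Mapping.lookup m (inv_into UNIV P (P i)) else 0)"
      by (rule multiplicity_prod_prime_powers) (use P(2) in auto)
    also have "\<dots> = Poly_Mapping.lookup m i"
      using P(1) by (auto simp: inj_image_mem_iff in_keys_iff)
    finally show ?thesis .
  qed
  then show "m = m'" if "monomial_value P m = monomial_value P m'" for m m'
    using that by (metis poly_mapping_eqI)
qed

text \<open>
  The monomials being chosen once and for all, each Gram determinant is a polynomial in the coefficients
  of the linear forms, and so is the product of the finitely many determinants. It takes a nonzero value at
  \<open>a\<^sub>j\<^sub>i = P\<^sub>i\<^sup>j\<close> for distinct primes \<open>P\<^sub>i\<close>: there a monomial takes the value \<open>y\<^sup>j\<close> at \<open>a\<^sub>j\<close>, where \<open>y\<close> is its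
  value at the primes. These nodes are distinct integers, and the weights are positive.
\<close>

lemma general_lefschetz_frames:
  assumes "1 \<le> n"
  shows "for_general_linear_forms n s
    (\<lambda>a :: nat \<times> nat \<Rightarrow> 'k::field_char_0. \<forall>k. 2 * k < d \<longrightarrow> (\<exists>ms. lefschetz_frame n d s a k ms))"
proof -
  let ?E = "{1..s} \<times> {1..n}"
  let ?M = "\<lambda>k. {m. Poly_Mapping.keys m \<subseteq> {1..n} \<and> mono_degree m = k}"
  have "\<forall>k. \<exists>ms. distinct ms \<and> set ms \<subseteq> ?M k \<and> length ms \<le> s \<and> (set ms = ?M k \<or> length ms = s)"
    using ex_exhaustive_or_full_list by blast
  from choice[OF this] obtain ms where "\<forall>k. distinct (ms k) \<and> set (ms k) \<subseteq> ?M k \<and> length (ms k) \<le> s \<and>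
      (set (ms k) = ?M k \<or> length (ms k) = s)" ..
  from spec[OF this] have ms: "distinct (ms k)" "set (ms k) \<subseteq> ?M k" "length (ms k) \<le> s"
    "set (ms k) = ?M k \<or> length (ms k) = s" for k
    by simp_all
  have keys: "Poly_Mapping.keys (ms k ! v) \<subseteq> {1..n}" if "v < length (ms k)" for k v
    using ms(2)[of k] nth_mem[OF that] by auto
  define x :: "nat \<Rightarrow> nat \<Rightarrow> (nat \<times> nat, 'k) mpoly" where "x j i = var_poly (j, i)" for j i
  define D where "D k = det (gram {1..s} (\<lambda>j. x j 1 ^ (d - 2 * k))
    (\<lambda>j v. monomial_value (x j) (ms k ! v)) (length (ms k)))" for k
  have D_polys: "D k \<in> polys ?E" for k
    unfolding D_def monomial_value_def
    by (intro det_gram_in_polys polys_power polys_prod)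
       (use keys[of _ k] assms in \<open>auto simp: x_def intro!: polys_var\<close>)
  have D_value: "eval_poly (D k) a = det (gram {1..s} (\<lambda>j. a (j, 1) ^ (d - 2 * k))
    (\<lambda>j v. monomial_value (\<lambda>i. a (j, i)) (ms k ! v)) (length (ms k)))" for k a
  proof -
    interpret comm_ring_hom "\<lambda>p. eval_poly p a" by (rule eval_poly_hom)
    show ?thesis
      unfolding D_def det_gram_hom[OF eval_poly_hom]
      by (simp add: monomial_value_def hom_power hom_prod x_def)
  qed
  define f where "f = (\<Prod>k | 2 * k < d. D k)"
  have fin: "finite {k. 2 * k < d}" by (rule finite_subset[of _ "{..d}"]) auto
  have f_value: "eval_poly f a \<noteq> 0 \<longleftrightarrow> (\<forall>k. 2 * k < d \<longrightarrow> eval_poly (D k) a \<noteq> 0)" for a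
  proof -
    interpret comm_ring_hom "\<lambda>p. eval_poly p a" by (rule eval_poly_hom)
    show ?thesis by (simp add: f_def hom_prod fin)
  qed
  define U where "U = {a \<in> ?E \<rightarrow>\<^sub>E UNIV. \<exists>g\<in>{f}. eval_poly g a \<noteq> 0}"
  have "zariski_open ?E U"
    unfolding zariski_open_def U_def using D_polys by (intro exI[of _ "{f}"]) (auto simp: f_def intro: polys_prod)
  moreover have "U \<noteq> {}"
  proof -
    define P where "P = enumerate {p::nat. prime p}"
    have P: "inj P" "\<And>i. prime (P i)"
      using primes_infinite enumerate_in_set[of "{p::nat. prime p}"] strict_mono_imp_inj_on strict_mono_enumerate
      by (auto simp: P_def)
    define a :: "nat \<times> nat \<Rightarrow> 'k" where "a = restrict (\<lambda>(j, i). of_nat (P i ^ j)) ?E"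
    have "eval_poly (D k) a \<noteq> 0" for k
    proof -
      let ?w = "\<lambda>j. (int (P 1 ^ j)) ^ (d - 2 * k)" and ?y = "\<lambda>v. int (monomial_value P (ms k ! v))"
      have "gram {1..s} (\<lambda>j. a (j, 1) ^ (d - 2 * k))
          (\<lambda>j v. monomial_value (\<lambda>i. a (j, i)) (ms k ! v)) (length (ms k))
        = gram {1..s} (\<lambda>j. of_int (?w j)) (\<lambda>j v. of_int (?y v ^ j)) (length (ms k))"
      proof (rule gram_cong)
        fix j v assume j: "j \<in> {1..s}" and v: "v < length (ms k)"
        have "monomial_value (\<lambda>i. a (j, i)) (ms k ! v) = monomial_value (\<lambda>i. of_nat (P i) ^ j) (ms k ! v)"
          unfolding monomial_value_def
          by (intro prod.cong refl) (use keys[OF v] j in \<open>auto simp: a_def\<close>)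
        also have "\<dots> = of_int (?y v ^ j)"
          by (simp add: monomial_value_def prod_power_distrib flip: power_mult) (simp add: mult.commute)
        finally show "monomial_value (\<lambda>i. a (j, i)) (ms k ! v) = of_int (?y v ^ j)" .
      qed (use assms in \<open>simp add: a_def\<close>)
      also have "det \<dots> \<noteq> 0"
      proof (rule gram_exponential_nonsingular)
        show "inj_on ?y {..<length (ms k)}"
          using injD[OF monomial_value_primes_inj[OF P]] nth_eq_iff_index_eq[OF ms(1)[of k]]
          by (simp add: inj_on_def) blast
        show "?y v \<noteq> 0" for v
          using prime_gt_0_nat[OF P(2)] by (simp add: monomial_value_def)
        show "?w j > 0" for j
          using prime_gt_0_nat[OF P(2), of 1] by simp
      qed (rule ms(3))
      finally show ?thesis by (simp add: D_value)
    qed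
    then have "a \<in> U" by (simp add: U_def f_value a_def)
    then show ?thesis by blast
  qed
  moreover have "\<forall>k. 2 * k < d \<longrightarrow> (\<exists>ms. lefschetz_frame n d s a k ms)" if "a \<in> U" for a
  proof (intro allI impI)
    fix k assume "2 * k < d"
    then have "eval_poly (D k) a \<noteq> 0" using that by (simp add: U_def f_value)
    then have "lefschetz_frame n d s a k (ms k)"
      unfolding lefschetz_frame_def D_value using ms[of k] by blast
    then show "\<exists>ms. lefschetz_frame n d s a k ms" by blast
  qed
  ultimately show ?thesis
    unfolding for_general_linear_forms_def by blast
qed

lemma for_general_linear_forms_mono:
  assumes "for_general_linear_forms n s Q" "\<And>a. Q a \<Longrightarrow> Q' a"
  shows "for_general_linear_forms n s Q'"
  using assms unfolding for_general_linear_forms_def by blast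

theorem theorem3p6:
  fixes n d s :: nat
  assumes "n \<ge> 2" and "d \<ge> 1" and "1 \<le> s" and "s \<le> (d + n - 1) choose d"
  shows "for_general_linear_forms n s
    (\<lambda>a :: nat \<times> nat \<Rightarrow> 'k :: {alg_closed_field, field_char_0}.
      power_sum n d s a \<noteq> 0 \<and>
      weak_lefschetz (macaulay_algebra {1..n} (power_sum n d s a))
        (macaulay_component {1..n} (power_sum n d s a)))"
proof -
  have "power_sum n d s a \<noteq> 0 \<and>
      weak_lefschetz (macaulay_algebra {1..n} (power_sum n d s a))
        (macaulay_component {1..n} (power_sum n d s a))"
    if frames: "\<forall>k. 2 * k < d \<longrightarrow> (\<exists>ms. lefschetz_frame n d s a k ms)"
    for a :: "nat \<times> nat \<Rightarrow> 'k"
  proof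
    obtain ms where "lefschetz_frame n d s a 0 ms" using frames assms(2) by fastforce
    then show "power_sum n d s a \<noteq> 0" using assms by (intro power_sum_nonzero) auto
    show "weak_lefschetz (macaulay_algebra {1..n} (power_sum n d s a))
        (macaulay_component {1..n} (power_sum n d s a))"
      using frames assms(1) by (intro lefschetz_frames_imp_weak_lefschetz) auto
  qed
  then show ?thesis
    using assms(1) by (intro for_general_linear_forms_mono[OF general_lefschetz_frames]) simp_all
qed

end
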